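(* Let $\mathcal S,\mathcal B\subset\mathbb R^p$ be bounded closed convex polytopes with non-empty interior. The outer approximation algorithm with initial approximation $\mathcal S$, using a point separating oracle $\mathsf{ptO}(\mathcal B)$ for $\mathcal B$, terminates with the polytope $\mathcal R=\mathcal B\cap\mathcal S$. The algorithm makes at most $v+f$ oracle calls, where $v$ is the number of vertices of $\mathcal R$ and $f$ is the number of facets of $\mathcal B$.
   Context: A halfspace in $\mathbb R^p$ is a set $H=\{y\in\mathbb R^p: yh\ge M\}$, where $h\in\mathbb R^p$ is a non-null vector, $M\in\mathbb R$, and $yh$ is the inner product. The positive side of $H$ is the open halfspace $\{y: yh>M\}$; the negative side is $\{y: yh<M\}$. A facet of a full-dimensional polytope in $\mathbb R^p$ is a face of dimension $p-1$; each facet is identified with the halfspace which contains the polytope and whose bounding hyperplane intersects the polytope in that facet. Point separating oracle $\mathsf{ptO}(\mathcal B)$: a black box which on input a point $v\in\mathbb R^p$ returns "inside" if $v\in\mathcal B$; otherwise it returns a halfspace $H$ corresponding to a facet of $\mathcal B$ such that $v$ is on the negative side of $H$ (any such answer is allowed). Outer approximation algorithm: Set $\mathcal S_0=\mathcal S$. In each approximating polytope certain vertices are marked "final"; initially no vertex is marked. Consider the $i$-th approximation $\mathcal S_i$. If all vertices of $\mathcal S_i$ are marked final, stop with result $\mathcal R=\mathcal S_i$. Otherwise pick any non-final vertex $v_i$ of $\mathcal S_i$ and call the oracle with the point $v_i$. If the oracle returns "inside", mark $v_i$ as final and repeat. Otherwise the oracle returns a halfspace $H$; let $\mathcal S_{i+1}=\mathcal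 S_i\cap H$, keep the "final" flag on previous vertices, and repeat. The statement holds for every choice of the picked vertices and for all admissible oracle answers. *)

theory Defs
  imports "HOL-Analysis.Analysis"
begin

definition halfspace :: "real^'p \<Rightarrow> real \<Rightarrow> (real^'p) set" where
  "halfspace h M = {y. y \<bullet> h \<ge> M}"

definition bounding_hyperplane :: "real^'p \<Rightarrow> real \<Rightarrow> (real^'p) set" where
  "bounding_hyperplane h M = {y. y \<bullet> h = M}"

definition negative_side :: "real^'p \<Rightarrow> real \<Rightarrow> (real^'p) set" where
  "negative_side h M = {y. y \<bullet> h < M}"

definition facet_halfspace :: "(real^'p) set \<Rightarrow> real^'p \<Rightarrow> real \<Rightarrow> bool" where
  "facet_halfspace P h M \<longleftrightarrow> h \<noteq> 0 \<and> P \<subseteq> halfspace h M \<and>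
     (P \<inter> bounding_hyperplane h M) facet_of P"

definition vertices :: "(real^'p) set \<Rightarrow> (real^'p) set" where
  "vertices P = {v. v extreme_point_of P}"

definition facets :: "(real^'p) set \<Rightarrow> (real^'p) set set" where
  "facets P = {F. F facet_of P}"

datatype 'p answer = Inside | Cut "(real^'p) set"

(* All admissible answers to the query v: the oracle is a relation, so it may also
   answer the same query differently at different times. *)
definition ptO :: "(real^'p) set \<Rightarrow> real^'p \<Rightarrow> 'p answer \<Rightarrow> bool" where
  "ptO B v a \<longleftrightarrow> (case a of
      Inside \<Rightarrow> v \<in> B
    | Cut H \<Rightarrow> v \<notin> B \<and>
        (\<exists>h M. facet_halfspace B h M \<and> H = halfspace h M \<and> v \<in> negative_side h M))"

(* A state (T, F) is the current approximation together with the set of points marked final.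
   A transition is exactly one oracle call, made at an arbitrary non-final vertex. *)
type_synonym 'p state = "(real^'p) set \<times> (real^'p) set"

inductive oracle_call :: "(real^'p) set \<Rightarrow> 'p state \<Rightarrow> 'p state \<Rightarrow> bool"
  for B :: "(real^'p) set" where
  inside: "v \<in> vertices T \<Longrightarrow> v \<notin> F \<Longrightarrow> ptO B v Inside \<Longrightarrow>
    oracle_call B (T, F) (T, insert v F)"
| cut: "v \<in> vertices T \<Longrightarrow> v \<notin> F \<Longrightarrow> ptO B v (Cut H) \<Longrightarrow>
    oracle_call B (T, F) (T \<inter> H, F)"

definition stopped :: "('p::finite) state \<Rightarrow> bool" where
  "stopped s \<longleftrightarrow> vertices (fst s) \<subseteq> snd s"

end

theory Submission
  imports Defs
begin

text \<open>
  Let \<open>R = B \<inter> S\<close>.  Every halfspace returned by the oracle contains \<open>B\<close>, so after any number of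
  calls the current approximation is \<open>T = S \<inter> \<Inter>C\<close>, where \<open>C\<close> is the set of the halfspaces
  returned so far, and \<open>R \<subseteq> T \<subseteq> S\<close>.  The bound on the number of calls comes from charging each
  call to a vertex of \<open>R\<close> or to a facet of \<open>B\<close>, and never twice to the same object.

  If the answer is ``inside'', then the queried point \<open>v\<close> is an extreme point of \<open>T\<close> that lies in
  the smaller set \<open>R\<close>, hence it is a vertex of \<open>R\<close>.  It was not final before the call, and it is
  final afterwards, so distinct calls of this kind are charged to distinct vertices.

  If the answer is a halfspace \<open>H\<close>, then \<open>v\<close> lies in all members of \<open>C\<close> but not in \<open>H\<close>, so \<open>H\<close>
  is new.  Since \<open>B\<close> is full-dimensional, a facet of \<open>B\<close> spans its bounding hyperplane and so
  determines the halfspace (\<open>facet_frontier_inj\<close>).  Distinct halfspaces are therefore charged to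
  distinct facets.  The resulting bound also excludes infinite runs.

  The lemma \<open>oracle_calls_invariant\<close> records this bookkeeping.  When all vertices of \<open>T\<close> are final,
  they all lie in \<open>B\<close>, and so does \<open>T\<close>, being the convex hull of its vertices; thus \<open>T = R\<close>.
  Finally the oracle can always answer (\<open>ptO_total\<close>), because a full-dimensional polytope is the
  intersection of the halfspaces of its facets; so a run can only end by stopping.
\<close>

definition facet_halfspaces :: "(real^'p) set \<Rightarrow> (real^'p) set set" where
  "facet_halfspaces B = {halfspace h M | h M. facet_halfspace B h M}"

lemma subset_facet_halfspace: "H \<in> facet_halfspaces B \<Longrightarrow> B \<subseteq> H"
  by (auto simp: facet_halfspaces_def facet_halfspace_def)

lemma polyhedron_facet_halfspace: "H \<in> facet_halfspaces B \<Longrightarrow> polyhedron H"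
  by (auto simp: facet_halfspaces_def halfspace_def inner_commute[of _ h for h]
      polyhedron_halfspace_ge)

lemma negative_side_iff: "v \<in> negative_side h M \<longleftrightarrow> v \<notin> halfspace h M"
  by (auto simp: negative_side_def halfspace_def)

lemma frontier_halfspace:
  "h \<noteq> 0 \<Longrightarrow> frontier (halfspace h M) = bounding_hyperplane h M"
  by (simp add: halfspace_def bounding_hyperplane_def inner_commute[of _ h]
      frontier_halfspace_ge)

lemma interior_nonempty_aff_dim:
  fixes B :: "(real^'p) set"
  assumes "interior B \<noteq> {}"
  shows "aff_dim B = int (CARD('p))"
  using aff_dim_nonempty_interior[OF assms] by simp

text \<open>A facet has codimension one in a full-dimensional set, and so does the hyperplane that
  contains it.\<close>

lemma affine_hull_facet:
  fixes B :: "(real^'p) set"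
  assumes "interior B \<noteq> {}" and "facet_halfspace B h M"
  shows "affine hull (B \<inter> bounding_hyperplane h M) = bounding_hyperplane h M"
proof (rule affine_dim_equal)
  have facet: "(B \<inter> bounding_hyperplane h M) facet_of B" and h: "h \<noteq> 0"
    using assms(2) by (auto simp: facet_halfspace_def)
  have hyp: "bounding_hyperplane h M = {y. h \<bullet> y = M}"
    by (simp add: bounding_hyperplane_def inner_commute)
  show aff: "affine (bounding_hyperplane h M)"
    by (simp add: hyp affine_hyperplane)
  show "affine hull (B \<inter> bounding_hyperplane h M) \<subseteq> bounding_hyperplane h M"
    by (intro hull_minimal aff) auto
  show "affine hull (B \<inter> bounding_hyperplane h M) \<noteq> {}"
    using facet by (auto simp: facet_of_def)
  show "aff_dim (affine hull (B \<inter> bounding_hyperplane h M)) = aff_dim (bounding_hyperplane h M)"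
    using facet interior_nonempty_aff_dim[OF assms(1)]
    by (simp add: facet_of_def hyp aff_dim_hyperplane[OF h])
qed auto

text \<open>Moving from an interior point of \<open>B\<close> towards a point outside \<open>halfspace k N\<close> crosses the
  common hyperplane, hence also leaves \<open>halfspace h M\<close>.\<close>

lemma halfspace_subset_of_same_hyperplane:
  assumes eq: "bounding_hyperplane h M = bounding_hyperplane k N"
    and b: "M < b \<bullet> h" "N < b \<bullet> k"
  shows "halfspace h M \<subseteq> halfspace k N"
proof
  fix y assume y: "y \<in> halfspace h M"
  show "y \<in> halfspace k N"
  proof (rule ccontr)
    assume "y \<notin> halfspace k N"
    then have less: "y \<bullet> k < N" by (simp add: halfspace_def)
    \<comment> \<open>The weight for which \<open>(1 - t) b + t y\<close> lies on the hyperplane of \<open>k\<close>.\<close>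
    define t where "t = (b \<bullet> k - N) / (b \<bullet> k - y \<bullet> k)"
    have t: "0 < t" "t < 1"
      using less b by (auto simp: t_def field_simps)
    define z where "z = (1 - t) *\<^sub>R b + t *\<^sub>R y"
    have "t * (b \<bullet> k - y \<bullet> k) = b \<bullet> k - N"
      using less b by (simp add: t_def)
    then have "z \<bullet> k = N"
      by (simp add: z_def inner_add_left algebra_simps)
    then have "z \<in> bounding_hyperplane k N"
      by (simp add: bounding_hyperplane_def)
    then have "z \<in> bounding_hyperplane h M"
      by (simp only: eq)
    then have "(1 - t) * (b \<bullet> h) + t * (y \<bullet> h) = M"
      by (simp add: bounding_hyperplane_def z_def inner_add_left)
    moreover have "(1 - t) * (b \<bullet> h) > (1 - t) * M" using t b by simp
    moreover have "t * (y \<bullet> h) \<ge> t * M" using t y by (simp add: halfspace_def)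
    moreover have "(1 - t) * M + t * M = M" by (simp add: algebra_simps)
    ultimately show False by linarith
  qed
qed

lemma interior_in_positive_side:
  assumes "b \<in> interior B" and "facet_halfspace B h M"
  shows "M < b \<bullet> h"
proof -
  have "b \<in> interior (halfspace h M)"
    using assms interior_mono by (auto simp: facet_halfspace_def)
  then show ?thesis
    using assms(2)
    by (simp add: facet_halfspace_def halfspace_def inner_commute[of _ h] interior_halfspace_ge)
qed

text \<open>The facet of \<open>B\<close> belonging to a facet halfspace \<open>H\<close> is \<open>B \<inter> frontier H\<close>.  It determines the
  bounding hyperplane as its affine hull, and then \<open>H\<close> as the side that contains \<open>B\<close>.\<close>

lemma facet_frontier_inj:
  fixes B :: "(real^'p) set"
  assumes "interior B \<noteq> {}"
  shows "inj_on (\<lambda>H. B \<inter> frontier H) (facet_halfspaces B)"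
proof (rule inj_onI)
  fix H K
  assume "H \<in> facet_halfspaces B" "K \<in> facet_halfspaces B"
    and same: "B \<inter> frontier H = B \<inter> frontier K"
  then obtain h M k N where H: "H = halfspace h M" "facet_halfspace B h M"
    and K: "K = halfspace k N" "facet_halfspace B k N"
    by (auto simp: facet_halfspaces_def)
  then have "B \<inter> bounding_hyperplane h M = B \<inter> bounding_hyperplane k N"
    using same by (auto simp: facet_halfspace_def frontier_halfspace)
  then have eq: "bounding_hyperplane h M = bounding_hyperplane k N"
    using affine_hull_facet[OF assms] H K by metis
  obtain b where "b \<in> interior B" using assms by blast
  then have "M < b \<bullet> h" "N < b \<bullet> k"
    using H K interior_in_positive_side by auto
  then show "H = K"
    using halfspace_subset_of_same_hyperplane eq H K by (metis subset_antisym)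
qed

lemma facet_halfspaces_finite_card:
  fixes B :: "(real^'p) set"
  assumes "polytope B" and "interior B \<noteq> {}"
  shows "finite (facet_halfspaces B)" "card (facet_halfspaces B) \<le> card (facets B)"
proof -
  have fin: "finite (facets B)"
    using assms(1) finite_polytope_facets by (simp add: facets_def)
  have "(\<lambda>H. B \<inter> frontier H) ` facet_halfspaces B \<subseteq> facets B"
    by (auto simp: facet_halfspaces_def facets_def facet_halfspace_def frontier_halfspace)
  then show "finite (facet_halfspaces B)" "card (facet_halfspaces B) \<le> card (facets B)"
    using facet_frontier_inj[OF assms(2)] fin
    by (meson inj_on_finite, meson card_inj_on_le)
qed

text \<open>In an irredundant representation of \<open>B\<close> by halfspaces each of them defines a facet,
  and a point outside \<open>B\<close> violates one of them.\<close>

lemma ptO_total: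
  fixes B :: "(real^'p) set"
  assumes "polyhedron B" and int: "interior B \<noteq> {}"
  shows "\<exists>a. ptO B v a"
proof (cases "v \<in> B")
  case True
  then have "ptO B v Inside" by (simp add: ptO_def)
  then show ?thesis ..
next
  case False
  have hull: "affine hull B = UNIV"
    using int by (rule affine_hull_nonempty_interior)
  obtain \<F> where \<F>: "finite \<F>" and B: "B = affine hull B \<inter> \<Inter>\<F>"
    and half: "\<forall>H\<in>\<F>. \<exists>a b. a \<noteq> 0 \<and> H = {x. a \<bullet> x \<le> b}"
    and minimal: "\<And>\<G>. \<G> \<subset> \<F> \<Longrightarrow> B \<subset> affine hull B \<inter> \<Inter>\<G>"
    using assms(1) by (auto simp: polyhedron_Int_affine_minimal)
  obtain a b where ab: "\<And>H. H \<in> \<F> \<Longrightarrow> a H \<noteq> 0 \<and> H = {x. a H \<bullet> x \<le> b H}"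
    using half by metis
  obtain H where H: "H \<in> \<F>" "v \<notin> H"
    using False B hull by auto
  have "(B \<inter> {x. a H \<bullet> x = b H}) facet_of B"
    using facet_of_polyhedron_explicit[OF \<F> B ab minimal] H by blast
  moreover have "bounding_hyperplane (- a H) (- b H) = {x. a H \<bullet> x = b H}"
    by (simp add: bounding_hyperplane_def inner_commute)
  moreover have Heq: "H = halfspace (- a H) (- b H)"
    using ab[OF H(1)] by (simp add: halfspace_def inner_commute)
  moreover have "B \<subseteq> H" using B H by blast
  ultimately have "facet_halfspace B (- a H) (- b H)"
    using ab[OF H(1)] by (simp add: facet_halfspace_def)
  moreover have "v \<in> negative_side (- a H) (- b H)"
    using H(2) Heq negative_side_iff by metis
  ultimately have "ptO B v (Cut H)"
    using False Heq by (auto simp: ptO_def)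
  then show ?thesis ..
qed

text \<open>The set \<open>C\<close> consists of the halfspaces returned so far.  The exact count in the last conjunct
  expresses that no vertex is confirmed twice and no halfspace is returned twice.\<close>

lemma oracle_calls_invariant:
  fixes S B :: "(real^'p) set"
  assumes "polytope B" and "interior B \<noteq> {}" and "polytope S"
    and "(oracle_call B ^^ n) (S, {}) (T, F)"
  shows "\<exists>C. C \<subseteq> facet_halfspaces B \<and> T = S \<inter> \<Inter>C \<and> F \<subseteq> vertices (B \<inter> S) \<and>
    n = card F + card C"
  using assms(4)
proof (induction n arbitrary: T F)
  case 0
  then show ?case by (intro exI[of _ "{}"]) auto
next
  case (Suc n)
  then obtain s where run: "(oracle_call B ^^ n) (S, {}) s" and call: "oracle_call B s (T, F)"
    by auto
  obtain T' F' where s: "s = (T', F')" by (cases s)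
  obtain C where C: "C \<subseteq> facet_halfspaces B" "T' = S \<inter> \<Inter>C" "F' \<subseteq> vertices (B \<inter> S)"
      "n = card F' + card C"
    using Suc.IH run s by blast
  have finF: "finite F'"
    using C(3) assms finite_polyhedron_extreme_points[of "B \<inter> S"]
    by (auto simp: vertices_def polytope_Int polytope_imp_polyhedron intro: finite_subset)
  have finC: "finite C"
    using C(1) facet_halfspaces_finite_card(1)[OF assms(1,2)] finite_subset by blast
  have sub: "B \<inter> S \<subseteq> T'"
    using C subset_facet_halfspace by blast
  from call show ?case
    unfolding s
  proof cases
    case (inside v)
    have "v \<in> T'" using inside by (auto simp: vertices_def extreme_point_of_def)
    then have "v \<in> B \<inter> S" using inside C by (auto simp: ptO_def)
    then have "v \<in> vertices (B \<inter> S)"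
      using inside(3) sub by (auto simp: vertices_def extreme_point_of_def)
    then show ?thesis
      using C inside finF by (intro exI[of _ C]) auto
  next
    case (cut v H)
    have "v \<in> T'" using cut by (auto simp: vertices_def extreme_point_of_def)
    moreover have "v \<notin> H" "H \<in> facet_halfspaces B"
      using cut by (auto simp: ptO_def facet_halfspaces_def halfspace_def negative_side_def)
    ultimately have "H \<notin> C" "H \<in> facet_halfspaces B" using C by auto
    then show ?thesis
      using C cut finC by (intro exI[of _ "insert H C"]) auto
  qed
qed

lemma oracle_calls_bound:
  fixes S B :: "(real^'p) set"
  assumes "polytope B" and "interior B \<noteq> {}" and "polytope S"
    and "(oracle_call B ^^ n) (S, {}) (T, F)"
  shows "n \<le> card (vertices (B \<inter> S)) + card (facets B)"
proof -
  obtain C where C: "C \<subseteq> facet_halfspaces B" "F \<subseteq> vertices (B \<inter> S)" "n = card F + card C"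
    using oracle_calls_invariant[OF assms] by blast
  have "finite (vertices (B \<inter> S))"
    using assms finite_polyhedron_extreme_points[of "B \<inter> S"]
    by (simp add: vertices_def polytope_Int polytope_imp_polyhedron)
  then have "card F \<le> card (vertices (B \<inter> S))"
    using C(2) by (rule card_mono)
  moreover have "card C \<le> card (facets B)"
    using card_mono[OF _ C(1)] facet_halfspaces_finite_card[OF assms(1,2)] by linarith
  ultimately show ?thesis using C(3) by linarith
qed

lemma stopped_result:
  fixes S B :: "(real^'p) set"
  assumes "polytope B" and "interior B \<noteq> {}" and "polytope S"
    and "(oracle_call B ^^ n) (S, {}) (T, F)" and "stopped (T, F)"
  shows "T = B \<inter> S"
proof
  obtain C where C: "C \<subseteq> facet_halfspaces B" "T = S \<inter> \<Inter>C" "F \<subseteq> vertices (B \<inter> S)"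
    using oracle_calls_invariant[OF assms(1-4)] by blast
  show "B \<inter> S \<subseteq> T"
    using C subset_facet_halfspace by blast
  have "closed H \<and> convex H" if "H \<in> C" for H
    using that C(1) polyhedron_facet_halfspace polyhedron_imp_closed polyhedron_imp_convex
    by blast
  then have "closed (\<Inter>C)" "convex (\<Inter>C)"
    by (auto intro!: closed_Inter convex_Inter)
  then have "compact T" "convex T"
    unfolding C(2) using polytope_imp_compact[OF assms(3)] polytope_imp_convex[OF assms(3)]
    by (simp_all add: compact_Int_closed convex_Int)
  then have "T = convex hull (vertices T)"
    unfolding vertices_def by (rule Krein_Milman_Minkowski)
  moreover have "vertices T \<subseteq> B"
    using assms(5) C(3) by (auto simp: stopped_def vertices_def extreme_point_of_def)
  ultimately have "T \<subseteq> B"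
    using hull_minimal[of "vertices T" B convex] polytope_imp_convex[OF assms(1)] by simp
  then show "T \<subseteq> B \<inter> S" using C(2) by blast
qed

theorem theorem5:
  fixes S B :: "(real^'p) set"
  assumes "polytope S" and "interior S \<noteq> {}"
    and "polytope B" and "interior B \<noteq> {}"
  shows "polytope (B \<inter> S) \<and>
    (\<nexists>run. run 0 = (S, {}) \<and> (\<forall>i::nat. oracle_call B (run i) (run (Suc i)))) \<and>
    (\<forall>n T F. (oracle_call B ^^ n) (S, {}) (T, F) \<longrightarrow>
       n \<le> card (vertices (B \<inter> S)) + card (facets B) \<and>
       (stopped (T, F) \<longrightarrow> T = B \<inter> S) \<and>
       (\<forall>v \<in> vertices T - F. \<exists>a. ptO B v a))"
proof (intro conjI allI impI ballI)
  show "polytope (B \<inter> S)" using assms by (simp add: polytope_Int)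
  show "\<nexists>run. run 0 = (S, {}) \<and> (\<forall>i::nat. oracle_call B (run i) (run (Suc i)))"
  proof
    assume "\<exists>run. run 0 = (S, {}) \<and> (\<forall>i::nat. oracle_call B (run i) (run (Suc i)))"
    then obtain run where run: "run 0 = (S, {})" "\<And>i::nat. oracle_call B (run i) (run (Suc i))"
      by blast
    have "(oracle_call B ^^ n) (S, {}) (run n)" for n
      by (induction n) (use run in auto)
    then have "n \<le> card (vertices (B \<inter> S)) + card (facets B)" for n
      using oracle_calls_bound[OF assms(3,4,1)] by (metis surj_pair)
    then show False using not_less_eq_eq by blast
  qed
next
  fix n T F
  assume "(oracle_call B ^^ n) (S, {}) (T, F)"
  then show "n \<le> card (vertices (B \<inter> S)) + card (facets B)"
    by (rule oracle_calls_bound[OF assms(3,4,1)])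
next
  fix n T F
  assume "(oracle_call B ^^ n) (S, {}) (T, F)" and "stopped (T, F)"
  then show "T = B \<inter> S"
    by (rule stopped_result[OF assms(3,4,1)])
next
  fix v show "\<exists>a. ptO B v a"
    using polytope_imp_polyhedron[OF assms(3)] assms(4) by (rule ptO_total)
qed

end
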